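(* Let $K\ge 1$ and $N\ge 1$ be integers, and let $\theta\ge 1$, $\sigma^2>0$, $p_{\max}>0$ be real numbers. For each $k\in\{1,\ldots,K\}$ let $g_{k,1},\ldots,g_{k,N}$ be exponentially distributed random variables with unit mean whose dependence is modeled by the $N$-dimensional Gumbel copula with parameter $\theta$, and suppose that the random vectors $(g_{k,1},\ldots,g_{k,N})$, $k=1,\ldots,K$, are mutually independent. Let $g_k=\max_{1\le n\le N} g_{k,n}$ and let $$\mathrm{MSE}=\frac{\sigma^2}{p_{\max}}\max_{1\le k\le K}\frac{1}{g_k}.$$ Then for every $\tau>0$, the function $F_{\mathrm{MSE}}(\tau)=\Pr(\mathrm{MSE}<\tau)$ is given by $$F_{\mathrm{MSE}}(\tau)=\left[1-\exp\!\left(-\left(\sum_{n=1}^{N}\Bigl(-\ln\bigl(1-e^{-\sigma^2/(p_{\max}\tau)}\bigr)\Bigr)^{\theta}\right)^{1/\theta}\right)\right]^{K}.$$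
   Context: The $d$-dimensional Gumbel copula with parameter $\theta\ge 1$ is the function $$C_{\mathrm G}(u_1,\ldots,u_d)=\exp\!\left(-\left(\sum_{i=1}^{d}(-\ln u_i)^{\theta}\right)^{1/\theta}\right),\qquad u_1,\ldots,u_d\in(0,1],$$ with value $0$ if some $u_i=0$. To say that the dependence of random variables $X_1,\ldots,X_d$ with continuous marginal CDFs $F_{X_1},\ldots,F_{X_d}$ is modeled by a copula $C$ means that their joint CDF satisfies $\Pr(X_1\le x_1,\ldots,X_d\le x_d)=C(F_{X_1}(x_1),\ldots,F_{X_d}(x_d))$ for all real $x_1,\ldots,x_d$. The unit-mean exponential distribution has CDF $1-e^{-x}$ for $x\ge 0$ (and $0$ for $x<0$); in particular each $g_k$ is almost surely positive, so $\mathrm{MSE}$ is almost surely well defined. Interpretation: $g_{k,n}=|h_{k,n}|^2$ is the channel power gain of user $k$ at the $n$-th fluid-antenna port under Rayleigh fading, $g_k$ is the gain of the selected (best) port of user $k$, $\sigma^2$ is the noise power, $p_{\max}$ is the transmit power budget of each user, and $\mathrm{MSE}$ is the over-the-air aggregation mean-squared error under zero-forcing transmit scaling. *)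

theory Defs
  imports "HOL-Probability.Probability"
begin

(* Vectors of dimension d are functions on nat of which only the coordinates 1..d are used.
   For 0 < u i <= 1 the base - ln (u i) is nonnegative, and 0 powr a = 0, so powr is the
   usual real power here, including at u i = 1. *)
definition gumbel_copula :: "nat \<Rightarrow> real \<Rightarrow> (nat \<Rightarrow> real) \<Rightarrow> real" where
  "gumbel_copula d \<theta> u =
     (if \<exists>i\<in>{1..d}. u i = 0 then 0
      else exp (- ((\<Sum>i=1..d. (- ln (u i)) powr \<theta>) powr (1 / \<theta>))))"

definition modeled_by_copula ::
  "'a measure \<Rightarrow> nat \<Rightarrow> ((nat \<Rightarrow> real) \<Rightarrow> real) \<Rightarrow> (nat \<Rightarrow> 'a \<Rightarrow> real) \<Rightarrow> bool" where
  "modeled_by_copula M d C X \<longleftrightarrow>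
     (\<forall>i\<in>{1..d}. X i \<in> borel_measurable M \<and> continuous_on UNIV (cdf (distr M borel (X i)))) \<and>
     (\<forall>x. measure M {\<omega> \<in> space M. \<forall>i\<in>{1..d}. X i \<omega> \<le> x i} =
          C (\<lambda>i. cdf (distr M borel (X i)) (x i)))"

definition best_gain :: "nat \<Rightarrow> (nat \<Rightarrow> nat \<Rightarrow> 'a \<Rightarrow> real) \<Rightarrow> nat \<Rightarrow> 'a \<Rightarrow> real" where
  "best_gain N g k \<omega> = (MAX n\<in>{1..N}. g k n \<omega>)"

(* If some best gain is 0, then 1 / 0 = 0 makes this value meaningless; for exponentially
   distributed gains this happens with probability 0. *)
definition mse ::
  "real \<Rightarrow> real \<Rightarrow> nat \<Rightarrow> nat \<Rightarrow> (nat \<Rightarrow> nat \<Rightarrow> 'a \<Rightarrow> real) \<Rightarrow> 'a \<Rightarrow> real" where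
  "mse noise pmax K N g \<omega> = noise / pmax * (MAX k\<in>{1..K}. 1 / best_gain N g k \<omega>)"

end

(* Almost surely every gain is positive, and then MSE < tau says exactly that the best gain of each
   user exceeds a = sigma^2 / (pmax tau).  The complementary event for a single user is that all
   its ports are at most a, whose probability is the copula at the constant vector 1 - exp (-a);
   independence across the users turns the intersection into a K-th power. *)
theory Submission
  imports Defs
begin

text \<open>The exponential CDF at 0 is 1 - exp 0 = 0. This keeps the reciprocals in
  \<open>mse\<close> away from the default value 1 / 0 = 0 outside a null set.\<close>

lemma (in prob_space) exponential_distributed_AE_pos:
  assumes D: "distributed M lborel X (exponential_density l)" and "0 < l"
  shows "AE \<omega> in M. 0 < X \<omega>"
proof -
  have X[measurable]: "X \<in> borel_measurable M"
    using distributed_measurable[OF D] by simp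
  have "prob {\<omega> \<in> space M. X \<omega> \<le> 0} = 0"
    using exponential_distributedD_le[OF D order_refl \<open>0 < l\<close>] by simp
  then have "AE \<omega> in M. \<omega> \<notin> {\<omega> \<in> space M. X \<omega> \<le> 0}"
    by (subst (asm) prob_eq_0) auto
  then show ?thesis by (rule AE_mp) (auto simp: not_le)
qed

lemma (in prob_space) cdf_exponential_distributed:
  assumes D: "distributed M lborel X (exponential_density l)" and "0 < l" and "0 \<le> x"
  shows "cdf (distr M borel X) x = 1 - exp (- x * l)"
proof -
  have [measurable]: "X \<in> borel_measurable M"
    using distributed_measurable[OF D] by simp
  have "cdf (distr M borel X) x = prob {\<omega> \<in> space M. X \<omega> \<le> x}"
    by (simp add: cdf_def measure_distr vimage_def Int_def conj_commute)
  then show ?thesis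
    using exponential_distributedD_le[OF D \<open>0 \<le> x\<close> \<open>0 < l\<close>] by simp
qed

lemma best_gain_greater_iff:
  assumes "N \<ge> 1"
  shows "a < best_gain N g k \<omega> \<longleftrightarrow> (\<exists>n\<in>{1..N}. a < g k n \<omega>)"
proof -
  have "finite ((\<lambda>n. g k n \<omega>) ` {1..N})" "(\<lambda>n. g k n \<omega>) ` {1..N} \<noteq> {}"
    using assms by auto
  then show ?thesis unfolding best_gain_def by (simp add: Max_gr_iff)
qed

text \<open>On positive gains the reciprocal reverses the order. Without \<open>pos\<close> the
  equivalence can fail: if all best gains are 0, the default 1 / 0 = 0 makes the left side true and
  the right side false.\<close>

lemma mse_less_iff:
  assumes "K \<ge> 1" and s: "s > 0" and p: "p > 0" and t: "t > 0"
    and pos: "\<And>k. k \<in> {1..K} \<Longrightarrow> 0 < best_gain N g k \<omega>"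
  shows "mse s p K N g \<omega> < t \<longleftrightarrow> (\<forall>k\<in>{1..K}. s / (p * t) < best_gain N g k \<omega>)"
proof -
  have "mse s p K N g \<omega> < t \<longleftrightarrow> (MAX k\<in>{1..K}. 1 / best_gain N g k \<omega>) < p * t / s"
    using s p unfolding mse_def by (simp add: field_simps)
  also have "\<dots> \<longleftrightarrow> (\<forall>k\<in>{1..K}. 1 / best_gain N g k \<omega> < p * t / s)"
    using \<open>K \<ge> 1\<close> by (subst Max_less_iff) auto
  also have "\<dots> \<longleftrightarrow> (\<forall>k\<in>{1..K}. s / (p * t) < best_gain N g k \<omega>)"
    using s p t pos by (intro ball_cong refl) (simp add: field_simps)
  finally show ?thesis .
qed

theorem mainTheorem2:
  fixes M :: "'a measure"
    and g :: "nat \<Rightarrow> nat \<Rightarrow> 'a \<Rightarrow> real"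
    and K N :: nat
    and \<theta> \<sigma> pmax \<tau> :: real
  assumes "prob_space M"
    and "K \<ge> 1" and "N \<ge> 1"
    and "\<theta> \<ge> 1" and "\<sigma>\<^sup>2 > 0" and "pmax > 0"
    and "\<And>k n. k \<in> {1..K} \<Longrightarrow> n \<in> {1..N} \<Longrightarrow> distributed M lborel (g k n) (exponential_density 1)"
    and "\<And>k. k \<in> {1..K} \<Longrightarrow> modeled_by_copula M N (gumbel_copula N \<theta>) (g k)"
    and "prob_space.indep_vars M (\<lambda>k. PiM {1..N} (\<lambda>n. borel))
           (\<lambda>k \<omega>. \<lambda>n\<in>{1..N}. g k n \<omega>) {1..K}"
    and "\<tau> > 0"
  shows "measure M {\<omega> \<in> space M. mse (\<sigma>\<^sup>2) pmax K N g \<omega> < \<tau>} =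
    (1 - exp (- ((\<Sum>n=1..N. (- ln (1 - exp (- (\<sigma>\<^sup>2 / (pmax * \<tau>))))) powr \<theta>) powr (1 / \<theta>)))) ^ K"
proof -
  interpret prob_space M by fact
  define a where "a = \<sigma>\<^sup>2 / (pmax * \<tau>)"
  define q where "q = exp (- ((\<Sum>n=1..N. (- ln (1 - exp (- a))) powr \<theta>) powr (1 / \<theta>)))"
  \<comment> \<open>Writing the event through single ports, not through \<open>best_gain\<close>,
    makes \<open>A k\<close> the preimage under the gain vector of user \<open>k\<close> of one set
    \<open>B\<close> that is the same for all users. Independence is assumed for these vectors, so
    this is the form needed below.\<close>
  define A where "A k = {\<omega> \<in> space M. \<exists>n\<in>{1..N}. a < g k n \<omega>}" for k
  define B where "B = {f \<in> space (PiM {1..N} (\<lambda>n. borel :: real measure)). \<exists>n\<in>{1..N}. a < f n}"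
  have a: "a > 0" unfolding a_def using assms by simp
  have meas: "g k n \<in> borel_measurable M" if "k \<in> {1..K}" "n \<in> {1..N}" for k n
    using distributed_measurable[OF assms(7)[OF that]] by simp
  have A: "A k \<in> events" if "k \<in> {1..K}" for k
    unfolding A_def using meas[OF that] by measurable
  have B: "B \<in> sets (PiM {1..N} (\<lambda>n. borel))"
    unfolding B_def by measurable
  have vimage: "(\<lambda>\<omega>. \<lambda>n\<in>{1..N}. g k n \<omega>) -` B \<inter> space M = A k" for k
    by (auto simp: A_def B_def space_PiM)

  \<comment> \<open>One port per user suffices, since the maximum over the ports dominates port 1,
    which exists because N is at least 1.\<close>
  have "AE \<omega> in M. \<forall>k\<in>{1..K}. 0 < g k 1 \<omega>"
    using assms(3,7) by (intro AE_finite_allI exponential_distributed_AE_pos[where l=1]) auto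
  then have AE: "AE \<omega> in M. mse (\<sigma>\<^sup>2) pmax K N g \<omega> < \<tau> \<longleftrightarrow> (\<forall>k\<in>{1..K}. \<omega> \<in> A k)"
  proof (rule AE_mp, intro AE_I2 impI)
    fix \<omega> assume "\<omega> \<in> space M" and pos: "\<forall>k\<in>{1..K}. 0 < g k 1 \<omega>"
    have "0 < best_gain N g k \<omega>" if "k \<in> {1..K}" for k
      using pos that assms(3) by (subst best_gain_greater_iff) (auto intro!: bexI[of _ 1])
    then have "mse (\<sigma>\<^sup>2) pmax K N g \<omega> < \<tau> \<longleftrightarrow> (\<forall>k\<in>{1..K}. a < best_gain N g k \<omega>)"
      unfolding a_def using assms by (intro mse_less_iff) auto
    also have "\<dots> \<longleftrightarrow> (\<forall>k\<in>{1..K}. \<omega> \<in> A k)"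
      using \<open>\<omega> \<in> space M\<close> assms(3) by (simp add: best_gain_greater_iff A_def)
    finally show "mse (\<sigma>\<^sup>2) pmax K N g \<omega> < \<tau> \<longleftrightarrow> (\<forall>k\<in>{1..K}. \<omega> \<in> A k)" .
  qed

  have probA: "prob (A k) = 1 - q" if k: "k \<in> {1..K}" for k
  proof -
    have cdf: "cdf (distr M borel (g k n)) a = 1 - exp (- a)" if "n \<in> {1..N}" for n
      using cdf_exponential_distributed[OF assms(7)[OF k that]] a by simp
    have "prob {\<omega> \<in> space M. \<forall>n\<in>{1..N}. g k n \<omega> \<le> a}
        = gumbel_copula N \<theta> (\<lambda>n. cdf (distr M borel (g k n)) a)"
      using assms(8)[OF k] unfolding modeled_by_copula_def
      by (elim conjE) (erule allE[where x="\<lambda>_. a"])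
    \<comment> \<open>As \<open>a\<close> is positive, 1 - exp (- a) is nonzero, so the exponential
      branch of the copula applies.\<close>
    also have "\<dots> = q"
      using a by (auto simp: gumbel_copula_def q_def cdf)
    also have "{\<omega> \<in> space M. \<forall>n\<in>{1..N}. g k n \<omega> \<le> a} = space M - A k"
      by (auto simp: A_def not_less)
    finally show ?thesis using prob_compl[OF A[OF k]] by simp
  qed

  \<comment> \<open>The two events below agree only up to a null set, so equality of their
    probabilities also requires this one to be measurable.\<close>
  have mse_event: "{\<omega> \<in> space M. mse (\<sigma>\<^sup>2) pmax K N g \<omega> < \<tau>} \<in> events"
  proof -
    have "best_gain N g k \<in> borel_measurable M" if "k \<in> {1..K}" for k
      unfolding best_gain_def[abs_def]
      using meas[OF that] by (intro borel_measurable_Max) auto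
    then have "mse (\<sigma>\<^sup>2) pmax K N g \<in> borel_measurable M"
      unfolding mse_def[abs_def]
      by (intro borel_measurable_times borel_measurable_const borel_measurable_Max
          borel_measurable_divide) auto
    then show ?thesis by measurable
  qed
  have "prob {\<omega> \<in> space M. mse (\<sigma>\<^sup>2) pmax K N g \<omega> < \<tau>} = prob (\<Inter>k\<in>{1..K}. A k)"
    using AE mse_event A assms(2)
    by (intro finite_measure_eq_AE) (auto intro!: sets.finite_INT)
  \<comment> \<open>Independence is used only across users, with \<open>B\<close> as the target set
    for each. The dependence between the ports of one user is already contained in
    \<open>q\<close>.\<close>
  also have "\<dots> = (\<Prod>k\<in>{1..K}. prob (A k))"
    using indep_varsD[OF assms(9), of "{1..K}" "\<lambda>_. B"] assms(2) B
    unfolding vimage by auto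
  also have "\<dots> = (1 - q) ^ K"
    using probA by simp
  finally show ?thesis unfolding q_def a_def .
qed

end
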